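(* Let $R$ be a local ring, and let $\sigma: R\to R$ be a ring endomorphism. If for every $a\in U(R)$ and $b\in J(R)$ the maps $l_{a}-r_{\sigma(b)}$, $l_{a}-r_{\sigma^2(b)}$ and $l_{b}-r_{\sigma(a)}$ from $R$ to $R$ are surjective, then $T_3(R,\sigma)$ is strongly clean.
   Context: All rings are associative with identity $1$, not necessarily commutative. $J(R)$ and $U(R)$ denote the Jacobson radical and the group of units of $R$. A ring is local if it has exactly one maximal right ideal. A ring endomorphism $\sigma$ of $R$ satisfies $\sigma(1)=1$, and $\sigma^2=\sigma\circ\sigma$. For a ring $R$ and an endomorphism $\sigma$ of $R$, $T_n(R,\sigma)$ is the ring of all $n\times n$ upper triangular matrices over $R$ with entrywise addition and multiplication $(a_{ij})(b_{ij})=(c_{ij})$, where $c_{ij}=\sum_{k=i}^{n}a_{ik}\sigma^{k-i}(b_{kj})$ for $i\le j$. For $a\in R$, $l_a,r_a: R\to R$ are the additive group endomorphisms $l_a(r)=ar$, $r_a(r)=ra$; thus $(l_a-r_b)(r)=ar-rb$. An element $a$ of a ring $S$ is strongly clean if there exist an idempotent $e\in S$ and a unit $u\in S$ with $a=e+u$ and $eu=ue$. A ring is strongly clean if all its elements are strongly clean. *)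

theory Defs
  imports "HOL-Algebra.Ideal" "HOL-Algebra.RingHom" "Jordan_Normal_Form.Matrix"
begin

text \<open>
  Rings are those of \<open>HOL-Algebra\<close>: associative, with identity, not necessarily commutative.
  The library's \<^const>\<open>ideal\<close> and \<^const>\<open>maximalideal\<close> are two-sided, so the
  one-sided notions are introduced here in the same style.
\<close>

locale right_ideal = additive_subgroup I R + ring R for I and R (structure) +
  assumes I_r_closed: "\<lbrakk>a \<in> I; x \<in> carrier R\<rbrakk> \<Longrightarrow> a \<otimes> x \<in> I"

locale maximal_right_ideal = right_ideal M R for M and R (structure) +
  assumes M_notcarr: "M \<noteq> carrier R"
    and M_maximal: "\<lbrakk>right_ideal J R; M \<subseteq> J\<rbrakk> \<Longrightarrow> J = M \<or> J = carrier R"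

locale local_ring = ring R for R (structure) +
  assumes unique_maximal_right_ideal: "\<exists>!M. maximal_right_ideal M R"

text \<open>
  The intersection with the carrier matters only for a ring without maximal right ideals
  (the zero ring), whose radical is the whole ring.
\<close>

definition jacobson_radical :: "('a, 'm) ring_scheme \<Rightarrow> 'a set" where
  "jacobson_radical R = carrier R \<inter> \<Inter> {M. maximal_right_ideal M R}"

text \<open>The additive map $l_a - r_b$.\<close>

definition left_minus_right :: "('a, 'm) ring_scheme \<Rightarrow> 'a \<Rightarrow> 'a \<Rightarrow> 'a \<Rightarrow> 'a" where
  "left_minus_right R a b = (\<lambda>r. a \<otimes>\<^bsub>R\<^esub> r \<ominus>\<^bsub>R\<^esub> r \<otimes>\<^bsub>R\<^esub> b)"

text \<open>
  $T_n(R,\sigma)$. Row and column indices run over $0,\dots,n-1$; the twist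
  $\sigma^{k-i}$ depends only on differences of indices, and there $i \le k$, so the
  subtraction on \<^typ>\<open>nat\<close> does not truncate. Only the type of matrices is taken from the
  matrix library; all operations are those of the ring \<open>R\<close>.
\<close>

definition skew_upper_triangular_ring ::
    "('a, 'm) ring_scheme \<Rightarrow> ('a \<Rightarrow> 'a) \<Rightarrow> nat \<Rightarrow> 'a mat ring" where
  "skew_upper_triangular_ring R \<sigma> n =
    \<lparr>carrier = {A \<in> carrier_mat n n. (\<forall>i<n. \<forall>j<n. A $$ (i, j) \<in> carrier R) \<and>
                  (\<forall>i<n. \<forall>j<i. A $$ (i, j) = \<zero>\<^bsub>R\<^esub>)},
     monoid.mult = (\<lambda>A B. mat n n (\<lambda>(i, j). if i \<le> j
               then \<Oplus>\<^bsub>R\<^esub>k\<in>{i..j}. A $$ (i, k) \<otimes>\<^bsub>R\<^esub> (\<sigma> ^^ (k - i)) (B $$ (k, j))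
               else \<zero>\<^bsub>R\<^esub>)),
     one = mat n n (\<lambda>(i, j). if i = j then \<one>\<^bsub>R\<^esub> else \<zero>\<^bsub>R\<^esub>),
     zero = mat n n (\<lambda>(i, j). \<zero>\<^bsub>R\<^esub>),
     add = (\<lambda>A B. mat n n (\<lambda>(i, j). A $$ (i, j) \<oplus>\<^bsub>R\<^esub> B $$ (i, j)))\<rparr>"

definition strongly_clean :: "('a, 'm) ring_scheme \<Rightarrow> 'a \<Rightarrow> bool" where
  "strongly_clean S a \<longleftrightarrow>
    (\<exists>e\<in>carrier S. \<exists>u\<in>Units S.
       e \<otimes>\<^bsub>S\<^esub> e = e \<and> a = e \<oplus>\<^bsub>S\<^esub> u \<and> e \<otimes>\<^bsub>S\<^esub> u = u \<otimes>\<^bsub>S\<^esub> e)"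

locale strongly_clean_ring = ring S for S (structure) +
  assumes strongly_clean: "a \<in> carrier S \<Longrightarrow> strongly_clean S a"

end

theory Submission
  imports Defs "HOL-Algebra.UnivPoly"
begin

text \<open>
  In a local ring every element lies in the radical or is a unit, and \<open>a\<close> is strongly clean
  if and only if \<open>1 - a\<close> is, so the first diagonal entry of the matrix \<open>A\<close> may be taken to be
  a unit. Look for an idempotent \<open>E\<close> commuting with \<open>A\<close> whose diagonal entries are \<open>1\<close> where
  those of \<open>A\<close> lie in the radical and \<open>0\<close> elsewhere; then \<open>A - E\<close> has units on the diagonal
  and is a unit. An off-diagonal entry \<open>x\<close> of \<open>E\<close> in position \<open>(i, j)\<close> with distinct diagonal
  entries \<open>e\<^sub>i\<close> and \<open>e\<^sub>j\<close> is found by solving a Sylvester equation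
  \<open>a\<^sub>i x - x \<sigma>\<^bsup>j-i\<^esup>(a\<^sub>j) = c\<close>, which is what the surjectivity hypotheses allow. If \<open>e\<^sub>i = e\<^sub>j\<close>,
  the entry is forced by \<open>E\<^sup>2 = E\<close>, and commutation in that position is automatic.
\<close>

section \<open>Units and strongly clean elements\<close>

lemma (in ring) Units_minus_closed:
  assumes "u \<in> Units R"
  shows "\<ominus> u \<in> Units R"
proof -
  obtain v where v: "v \<in> carrier R" "v \<otimes> u = \<one>" "u \<otimes> v = \<one>"
    using assms by (auto simp: Units_def)
  have u: "u \<in> carrier R"
    using assms by (rule Units_closed)
  have "\<ominus> v \<otimes> \<ominus> u = \<one>" "\<ominus> u \<otimes> \<ominus> v = \<one>"
    using u v by (simp_all add: l_minus r_minus)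
  then show ?thesis
    using u v unfolding Units_def by blast
qed

text \<open>The right inverse \<open>y\<close> of \<open>x\<close> lies in \<open>S\<close> again
  and so has a right inverse \<open>z\<close>. Associativity gives
  \<open>x = x(yz) = (xy)z = z\<close>, which makes \<open>y\<close> a two-sided inverse of
  \<open>x\<close>. This saves computing left inverses, both in a local ring and for triangular
  matrices.\<close>

lemma (in ring) Unit_if_right_invertible_closed:
  assumes S: "S \<subseteq> carrier R"
    and right_inv: "\<And>y. y \<in> S \<Longrightarrow> \<exists>z\<in>S. y \<otimes> z = \<one>"
    and x: "x \<in> S"
  shows "x \<in> Units R"
proof -
  obtain y where y: "y \<in> S" "x \<otimes> y = \<one>"
    using right_inv x by blast
  obtain z where z: "z \<in> S" "y \<otimes> z = \<one>"
    using right_inv y by blast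
  have "x = x \<otimes> (y \<otimes> z)"
    using x z S by auto
  also have "\<dots> = z"
    using x y z S by (subst m_assoc[symmetric]) auto
  finally show ?thesis
    using x y z S unfolding Units_def by auto
qed

text \<open>Expanding \<open>a e = e a\<close> with \<open>a = e + u\<close> and cancelling the
  idempotent leaves \<open>u e = e u\<close>. Commutation can thus be checked against the given
  element instead of the unit.\<close>

lemma (in ring) strongly_cleanI:
  assumes e: "e \<in> carrier R" "e \<otimes> e = e" and u: "u \<in> Units R"
    and a: "a = e \<oplus> u" "a \<otimes> e = e \<otimes> a"
  shows "strongly_clean R a"
proof -
  have "e \<oplus> u \<otimes> e = e \<oplus> e \<otimes> u"
    using e a(2) Units_closed[OF u] by (simp add: a(1) l_distr r_distr)
  then have "e \<otimes> u = u \<otimes> e"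
    using e Units_closed[OF u] by simp
  then show ?thesis
    using e u a(1) unfolding strongly_clean_def by blast
qed

text \<open>A decomposition \<open>b = e + u\<close> turns into \<open>a = (1 - e) + (-u)\<close>,
  with the complementary idempotent and the negated unit.\<close>

lemma (in ring) strongly_clean_complement:
  assumes "a \<in> carrier R" "b \<in> carrier R" "a \<oplus> b = \<one>" "strongly_clean R b"
  shows "strongly_clean R a"
proof -
  obtain e u where e: "e \<in> carrier R" "e \<otimes> e = e"
    and u: "u \<in> Units R" "u \<in> carrier R" and b: "b = e \<oplus> u" and comm: "e \<otimes> u = u \<otimes> e"
    using assms(4) by (auto simp: strongly_clean_def)
  have "a = (a \<oplus> b) \<ominus> b"
    using assms(1,2) by algebra
  also have "\<dots> = (\<one> \<ominus> e) \<oplus> \<ominus> u"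
    unfolding assms(3) unfolding b using e u by algebra
  finally have "a = (\<one> \<ominus> e) \<oplus> \<ominus> u" .
  moreover have "(\<one> \<ominus> e) \<otimes> (\<one> \<ominus> e) = \<one> \<ominus> e"
    using e by (simp add: minus_eq l_distr r_distr l_minus r_minus r_neg)
  moreover have "(\<one> \<ominus> e) \<otimes> \<ominus> u = \<ominus> u \<otimes> (\<one> \<ominus> e)"
    using e u comm by (simp add: minus_eq l_distr r_distr l_minus r_minus minus_add)
  ultimately show ?thesis
    using e u Units_minus_closed[OF u(1)] unfolding strongly_clean_def by blast
qed

text \<open>The element \<open>x\<close> is a preimage of \<open>d - c\<close>. The subtraction-free
  form of the equation is the shape in which an entry of \<open>A E = E A\<close> appears.\<close>

lemma (in ring) left_minus_right_surjD:
  assumes "left_minus_right R a b ` carrier R = carrier R"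
    and "a \<in> carrier R" "b \<in> carrier R" "c \<in> carrier R" "d \<in> carrier R"
  obtains x where "x \<in> carrier R" "a \<otimes> x \<oplus> c = d \<oplus> x \<otimes> b"
proof -
  have "d \<ominus> c \<in> left_minus_right R a b ` carrier R"
    using assms by simp
  then obtain x where x: "x \<in> carrier R" and eq: "a \<otimes> x \<ominus> x \<otimes> b = d \<ominus> c"
    by (auto simp: left_minus_right_def)
  have "a \<otimes> x \<oplus> c = (a \<otimes> x \<ominus> x \<otimes> b) \<oplus> (x \<otimes> b \<oplus> c)"
    using assms x by algebra
  also have "\<dots> = d \<oplus> x \<otimes> b"
    unfolding eq using assms x by algebra
  finally show thesis
    using that x by blast
qed

section \<open>Local rings\<close>

text \<open>Closure under negation comes for free from right multiplication by
  \<open>-1\<close>.\<close>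

lemma (in ring) right_idealI:
  assumes "I \<subseteq> carrier R" "\<zero> \<in> I"
    and "\<And>a b. \<lbrakk>a \<in> I; b \<in> I\<rbrakk> \<Longrightarrow> a \<oplus> b \<in> I"
    and "\<And>a x. \<lbrakk>a \<in> I; x \<in> carrier R\<rbrakk> \<Longrightarrow> a \<otimes> x \<in> I"
  shows "right_ideal I R"
proof -
  have "\<ominus> a \<in> I" if "a \<in> I" for a
    using assms(4)[OF that, of "\<ominus> \<one>"] that assms(1) by (auto simp: r_minus)
  then have "additive_subgroup I R"
    using assms by unfold_locales (auto simp: a_inv_def[symmetric])
  then show ?thesis
    using assms(4) by (simp add: right_ideal_def right_ideal_axioms_def ring_axioms)
qed

lemma (in right_ideal) one_imp_carrier:
  assumes "\<one> \<in> I"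
  shows "I = carrier R"
  using I_r_closed[OF assms] a_subset by force

text \<open>Zorn's lemma is applied to the right ideals that contain \<open>I\<close> and omit
  \<open>1\<close>. For a right ideal, omitting \<open>1\<close> amounts to being proper, and in
  this form properness visibly passes to unions of chains.\<close>

lemma (in right_ideal) subset_maximal_right_ideal:
  assumes "I \<noteq> carrier R"
  shows "\<exists>M. maximal_right_ideal M R \<and> I \<subseteq> M"
proof -
  define \<A> where "\<A> = {J. right_ideal J R \<and> I \<subseteq> J \<and> \<one> \<notin> J}"
  have "I \<in> \<A>"
    using assms one_imp_carrier right_ideal_axioms by (auto simp: \<A>_def)
  have "\<Union>\<C> \<in> \<A>" if ne: "\<C> \<noteq> {}" and ch: "subset.chain \<A> \<C>" for \<C>
  proof -
    have mem: "right_ideal J R" "I \<subseteq> J" "\<one> \<notin> J" if "J \<in> \<C>" for J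
      using ch that by (auto simp: \<A>_def subset.chain_def)
    have "right_ideal (\<Union>\<C>) R"
    proof (rule right_idealI)
      show "\<Union>\<C> \<subseteq> carrier R"
        using mem(1) by (auto simp: right_ideal_def dest: additive_subgroup.a_subset)
      show "\<zero> \<in> \<Union>\<C>"
        using ne mem(1) by (auto simp: right_ideal_def dest: additive_subgroup.zero_closed)
    next
      fix a b
      assume "a \<in> \<Union>\<C>" "b \<in> \<Union>\<C>"
      then obtain J where J: "J \<in> \<C>" "a \<in> J" "b \<in> J"
        using ch by (auto simp: subset.chain_def) blast
      then show "a \<oplus> b \<in> \<Union>\<C>"
        using additive_subgroup.a_closed[of J R a b] mem(1)[of J] by (auto simp: right_ideal_def)
    next
      fix a x
      assume "a \<in> \<Union>\<C>" "x \<in> carrier R"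
      then show "a \<otimes> x \<in> \<Union>\<C>"
        using mem(1) right_ideal.I_r_closed by (metis Union_iff)
    qed
    moreover have "I \<subseteq> \<Union>\<C>"
      using mem(2) ne by blast
    ultimately show ?thesis
      using mem(3) by (auto simp: \<A>_def)
  qed
  then obtain M where M: "M \<in> \<A>" and max: "\<And>J. \<lbrakk>J \<in> \<A>; M \<subseteq> J\<rbrakk> \<Longrightarrow> J = M"
    using subset_Zorn_nonempty[of \<A>] \<open>I \<in> \<A>\<close> by blast
  have "maximal_right_ideal M R"
  proof (intro maximal_right_ideal.intro maximal_right_ideal_axioms.intro)
    show "right_ideal M R" "M \<noteq> carrier R"
      using M by (auto simp: \<A>_def)
    fix J
    assume J: "right_ideal J R" "M \<subseteq> J"
    show "J = M \<or> J = carrier R"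
    proof (cases "\<one> \<in> J")
      case True
      then show ?thesis
        using right_ideal.one_imp_carrier J(1) by blast
    next
      case False
      then have "J \<in> \<A>"
        using J M by (auto simp: \<A>_def)
      then show ?thesis
        using max J(2) by blast
    qed
  qed
  then show ?thesis
    using M by (auto simp: \<A>_def)
qed

section \<open>The radical of a local ring and its complement\<close>

context local_ring
begin

lemma maximal_right_ideal_jacobson_radical: "maximal_right_ideal (jacobson_radical R) R"
proof -
  obtain M where M: "maximal_right_ideal M R" and "\<And>N. maximal_right_ideal N R \<Longrightarrow> N = M"
    using unique_maximal_right_ideal by blast
  then have "{M. maximal_right_ideal M R} = {M}"
    by blast
  moreover have "M \<subseteq> carrier R"
    using M by (simp add: maximal_right_ideal_def right_ideal_def additive_subgroup.a_subset)
  ultimately have "jacobson_radical R = M"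
    by (auto simp: jacobson_radical_def)
  with M show ?thesis
    by simp
qed

lemma right_ideal_jacobson_radical: "right_ideal (jacobson_radical R) R"
  using maximal_right_ideal_jacobson_radical maximal_right_ideal_def by blast

lemma additive_subgroup_jacobson_radical: "additive_subgroup (jacobson_radical R) R"
  using right_ideal_jacobson_radical by (simp add: right_ideal_def)

lemma one_notin_jacobson_radical: "\<one> \<notin> jacobson_radical R"
  using maximal_right_ideal_jacobson_radical right_ideal.one_imp_carrier
  by (auto simp: maximal_right_ideal_def maximal_right_ideal_axioms_def)

text \<open>Otherwise \<open>xR\<close> is a proper right ideal, hence contained in the only maximal
  right ideal, which is the radical; but \<open>x\<close> itself lies in \<open>xR\<close>.\<close>

lemma right_invertible_if_notin_jacobson_radical:
  assumes x: "x \<in> carrier R" "x \<notin> jacobson_radical R"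
  shows "\<exists>y\<in>carrier R. x \<otimes> y = \<one>"
proof (rule ccontr)
  define I where "I = (\<lambda>y. x \<otimes> y) ` carrier R"
  assume "\<not> ?thesis"
  then have "\<one> \<notin> I"
    by (auto simp: I_def)
  have "right_ideal I R"
  proof (rule right_idealI)
    show "I \<subseteq> carrier R"
      using x by (auto simp: I_def)
    show "\<zero> \<in> I"
      unfolding I_def by (rule image_eqI[of _ _ \<zero>]) (use x in auto)
  next
    fix a b
    assume "a \<in> I" "b \<in> I"
    then obtain r s where "r \<in> carrier R" "s \<in> carrier R" "a = x \<otimes> r" "b = x \<otimes> s"
      by (auto simp: I_def)
    then show "a \<oplus> b \<in> I"
      unfolding I_def by (intro image_eqI[of _ _ "r \<oplus> s"]) (use x in \<open>auto simp: r_distr\<close>)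
  next
    fix a y
    assume "a \<in> I" "y \<in> carrier R"
    then show "a \<otimes> y \<in> I"
      using x by (auto simp: I_def m_assoc)
  qed
  then obtain M where M: "maximal_right_ideal M R" "I \<subseteq> M"
    using right_ideal.subset_maximal_right_ideal[of I R] \<open>\<one> \<notin> I\<close> one_closed by blast
  have "x \<in> I"
    unfolding I_def by (rule image_eqI[of _ _ \<one>]) (use x in auto)
  then show False
    using M x(2) unique_maximal_right_ideal maximal_right_ideal_jacobson_radical by blast
qed

text \<open>Elements outside the radical have right inverses. It remains to see that such an inverse
  also lies outside the radical, so that the criterion for sets closed under right inverses
  applies.\<close>

lemma Unit_if_notin_jacobson_radical:
  assumes "x \<in> carrier R" "x \<notin> jacobson_radical R"
  shows "x \<in> Units R"
proof (rule Unit_if_right_invertible_closed[of "carrier R - jacobson_radical R"])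
  interpret J: right_ideal "jacobson_radical R" R
    by (rule right_ideal_jacobson_radical)
  fix x
  assume "x \<in> carrier R - jacobson_radical R"
  then have x: "x \<in> carrier R" "x \<notin> jacobson_radical R"
    by auto
  obtain y where y: "y \<in> carrier R" "x \<otimes> y = \<one>"
    using right_invertible_if_notin_jacobson_radical[OF x] by blast
  have "y \<notin> jacobson_radical R"
  proof
    assume "y \<in> jacobson_radical R"
    then have yx: "y \<otimes> x \<in> jacobson_radical R"
      using J.I_r_closed x by simp
    have "\<one> \<ominus> y \<otimes> x \<notin> jacobson_radical R"
    proof
      assume "\<one> \<ominus> y \<otimes> x \<in> jacobson_radical R"
      then have "\<one> \<ominus> y \<otimes> x \<oplus> y \<otimes> x \<in> jacobson_radical R"
        using yx by simp
      moreover have "\<one> \<ominus> y \<otimes> x \<oplus> y \<otimes> x = \<one>"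
        using x y(1) by algebra
      ultimately show False
        using one_notin_jacobson_radical by simp
    qed
    then obtain z where z: "z \<in> carrier R" "(\<one> \<ominus> y \<otimes> x) \<otimes> z = \<one>"
      using right_invertible_if_notin_jacobson_radical[of "\<one> \<ominus> y \<otimes> x"] x y by auto
    \<comment> \<open>Left multiplication by \<open>x\<close> kills \<open>1 - yx\<close>, because
      \<open>x(1 - yx) = x - (xy)x = 0\<close>. As \<open>1 - yx\<close> has the right inverse
      \<open>z\<close>, this forces \<open>x = 0\<close>, an element of the radical.\<close>
    have "x = x \<otimes> ((\<one> \<ominus> y \<otimes> x) \<otimes> z)"
      using x z by simp
    also have "\<dots> = x \<otimes> z \<ominus> (x \<otimes> y) \<otimes> (x \<otimes> z)"
      using x(1) y(1) z(1) by algebra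
    also have "\<dots> = \<zero>"
      unfolding y(2) using x(1) z(1) by algebra
    finally show False
      using x(2) J.zero_closed by simp
  qed
  with y show "\<exists>y\<in>carrier R - jacobson_radical R. x \<otimes> y = \<one>"
    by blast
qed (use assms in auto)

lemma Unit_one_minus_if_in_jacobson_radical:
  assumes "x \<in> jacobson_radical R"
  shows "\<one> \<ominus> x \<in> Units R"
proof (rule Unit_if_notin_jacobson_radical)
  interpret J: additive_subgroup "jacobson_radical R" R
    by (rule additive_subgroup_jacobson_radical)
  have x: "x \<in> carrier R"
    using assms J.a_subset by blast
  then show "\<one> \<ominus> x \<in> carrier R"
    by simp
  show "\<one> \<ominus> x \<notin> jacobson_radical R"
  proof
    assume "\<one> \<ominus> x \<in> jacobson_radical R"
    then have "\<one> \<ominus> x \<oplus> x \<in> jacobson_radical R"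
      using assms by simp
    moreover have "\<one> \<ominus> x \<oplus> x = \<one>"
      using x by algebra
    ultimately show False
      using one_notin_jacobson_radical by simp
  qed
qed

end

section \<open>Skew upper triangular matrices\<close>

locale ring_endomorphism = ring R for R (structure) +
  fixes \<sigma> :: "'a \<Rightarrow> 'a"
  assumes \<sigma>: "\<sigma> \<in> Ring.ring_hom R R"
begin

section \<open>Iterates of the endomorphism\<close>

lemma funpow_ring_hom: "ring_hom_ring R R (\<sigma> ^^ k)"
proof (induction k)
  case 0
  show ?case
    by (rule ring_hom_ringI) (auto simp: ring_axioms)
next
  case (Suc k)
  have "\<sigma> \<circ> \<sigma> ^^ k \<in> Ring.ring_hom R R"
    by (rule ring_hom_trans[OF ring_hom_ring.homh[OF Suc] \<sigma>])
  then show ?case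
    unfolding funpow.simps by (rule ring_hom_ringI2[OF ring_axioms ring_axioms])
qed

lemma funpow_hom_closed [simp]: "x \<in> carrier R \<Longrightarrow> (\<sigma> ^^ k) x \<in> carrier R"
  and funpow_hom_mult [simp]:
    "\<lbrakk>x \<in> carrier R; y \<in> carrier R\<rbrakk> \<Longrightarrow> (\<sigma> ^^ k) (x \<otimes> y) = (\<sigma> ^^ k) x \<otimes> (\<sigma> ^^ k) y"
  and funpow_hom_add [simp]:
    "\<lbrakk>x \<in> carrier R; y \<in> carrier R\<rbrakk> \<Longrightarrow> (\<sigma> ^^ k) (x \<oplus> y) = (\<sigma> ^^ k) x \<oplus> (\<sigma> ^^ k) y"
  and funpow_hom_one [simp]: "(\<sigma> ^^ k) \<one> = \<one>"
  and funpow_hom_zero [simp]: "(\<sigma> ^^ k) \<zero> = \<zero>"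
proof -
  interpret k: ring_hom_ring R R "\<sigma> ^^ k"
    by (rule funpow_ring_hom)
  show "x \<in> carrier R \<Longrightarrow> (\<sigma> ^^ k) x \<in> carrier R"
    and "\<lbrakk>x \<in> carrier R; y \<in> carrier R\<rbrakk> \<Longrightarrow> (\<sigma> ^^ k) (x \<otimes> y) = (\<sigma> ^^ k) x \<otimes> (\<sigma> ^^ k) y"
    and "\<lbrakk>x \<in> carrier R; y \<in> carrier R\<rbrakk> \<Longrightarrow> (\<sigma> ^^ k) (x \<oplus> y) = (\<sigma> ^^ k) x \<oplus> (\<sigma> ^^ k) y"
    and "(\<sigma> ^^ k) \<one> = \<one>" and "(\<sigma> ^^ k) \<zero> = \<zero>"
    by simp_all
qed

text \<open>These are the rules for the first iterate. They are kept separately because three by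
  three products are written with nested applications of \<open>\<sigma>\<close> instead of
  powers.\<close>

lemma hom_closed [simp]: "x \<in> carrier R \<Longrightarrow> \<sigma> x \<in> carrier R"
  and hom_mult [simp]:
    "\<lbrakk>x \<in> carrier R; y \<in> carrier R\<rbrakk> \<Longrightarrow> \<sigma> (x \<otimes> y) = \<sigma> x \<otimes> \<sigma> y"
  and hom_add [simp]:
    "\<lbrakk>x \<in> carrier R; y \<in> carrier R\<rbrakk> \<Longrightarrow> \<sigma> (x \<oplus> y) = \<sigma> x \<oplus> \<sigma> y"
  and hom_one [simp]: "\<sigma> \<one> = \<one>"
  and hom_zero [simp]: "\<sigma> \<zero> = \<zero>"
  using funpow_hom_closed[of x 1] funpow_hom_mult[of x y 1] funpow_hom_add[of x y 1]
    funpow_hom_one[of 1] funpow_hom_zero[of 1]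
  by (simp_all del: funpow_hom_closed funpow_hom_mult funpow_hom_add funpow_hom_one funpow_hom_zero)

lemma funpow_finsum:
  "f \<in> A \<rightarrow> carrier R \<Longrightarrow> (\<sigma> ^^ k) (\<Oplus>i\<in>A. f i) = (\<Oplus>i\<in>A. (\<sigma> ^^ k) (f i))"
  using ring_hom_ring.hom_finsum[OF funpow_ring_hom, of f A] by (simp add: comp_def)

section \<open>Ring axioms for the twisted matrix product\<close>

abbreviation T :: "nat \<Rightarrow> 'a mat ring" where
  "T n \<equiv> skew_upper_triangular_ring R \<sigma> n"

lemma T_carrier_iff:
  "A \<in> carrier (T n) \<longleftrightarrow> dim_row A = n \<and> dim_col A = n \<and>
    (\<forall>i<n. \<forall>j<n. A $$ (i, j) \<in> carrier R) \<and> (\<forall>i<n. \<forall>j<i. A $$ (i, j) = \<zero>)"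
  by (auto simp: skew_upper_triangular_ring_def)

lemma T_entry_closed: "\<lbrakk>A \<in> carrier (T n); i < n; j < n\<rbrakk> \<Longrightarrow> A $$ (i, j) \<in> carrier R"
  and T_entry_zero: "\<lbrakk>A \<in> carrier (T n); i < n; j < i\<rbrakk> \<Longrightarrow> A $$ (i, j) = \<zero>"
  by (simp_all add: T_carrier_iff)

lemma T_mult: "A \<otimes>\<^bsub>T n\<^esub> B = mat n n (\<lambda>(i, j). if i \<le> j
    then \<Oplus>k\<in>{i..j}. A $$ (i, k) \<otimes> (\<sigma> ^^ (k - i)) (B $$ (k, j)) else \<zero>)"
  and T_one: "\<one>\<^bsub>T n\<^esub> = mat n n (\<lambda>(i, j). if i = j then \<one> else \<zero>)"
  and T_zero: "\<zero>\<^bsub>T n\<^esub> = mat n n (\<lambda>(i, j). \<zero>)"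
  and T_add: "A \<oplus>\<^bsub>T n\<^esub> B = mat n n (\<lambda>(i, j). A $$ (i, j) \<oplus> B $$ (i, j))"
  by (simp_all add: skew_upper_triangular_ring_def)

lemma T_eqI:
  assumes "A \<in> carrier (T n)" "B \<in> carrier (T n)"
    and "\<And>i j. \<lbrakk>i \<le> j; j < n\<rbrakk> \<Longrightarrow> A $$ (i, j) = B $$ (i, j)"
  shows "A = B"
proof (rule eq_matI)
  fix i j
  assume "i < dim_row B" "j < dim_col B"
  then show "A $$ (i, j) = B $$ (i, j)"
    using assms by (cases "i \<le> j") (auto simp: T_carrier_iff)
qed (use assms in \<open>auto simp: T_carrier_iff\<close>)

lemma T_mult_closed:
  assumes "A \<in> carrier (T n)" "B \<in> carrier (T n)"
  shows "A \<otimes>\<^bsub>T n\<^esub> B \<in> carrier (T n)"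
  using assms unfolding T_carrier_iff[of "A \<otimes>\<^bsub>T n\<^esub> B"]
  by (auto simp: T_mult T_entry_closed intro!: finsum_closed)

lemma T_add_closed:
  "\<lbrakk>A \<in> carrier (T n); B \<in> carrier (T n)\<rbrakk> \<Longrightarrow> A \<oplus>\<^bsub>T n\<^esub> B \<in> carrier (T n)"
  by (simp add: T_carrier_iff T_add)

text \<open>Both sides are the sum over \<open>i \<le> k \<le> l \<le> j\<close> of
  \<open>a_ik \<sigma>^(k-i)(b_kl) \<sigma>^(l-i)(c_lj)\<close>. To exchange the two summations, the
  triangular range is enlarged to a square, where the extra terms vanish, and cut down again
  afterwards.\<close>

lemma T_assoc:
  assumes A: "A \<in> carrier (T n)" and B: "B \<in> carrier (T n)" and C: "C \<in> carrier (T n)"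
  shows "A \<otimes>\<^bsub>T n\<^esub> B \<otimes>\<^bsub>T n\<^esub> C = A \<otimes>\<^bsub>T n\<^esub> (B \<otimes>\<^bsub>T n\<^esub> C)"
proof (rule T_eqI)
  fix i j
  assume ij: "i \<le> j" "j < n"
  note [simp] = T_entry_closed[OF A] T_entry_closed[OF B] T_entry_closed[OF C]
  let ?a = "\<lambda>k. A $$ (i, k)" and ?b = "\<lambda>k l. B $$ (k, l)" and ?c = "\<lambda>l. C $$ (l, j)"
  have "(A \<otimes>\<^bsub>T n\<^esub> B \<otimes>\<^bsub>T n\<^esub> C) $$ (i, j) =
      (\<Oplus>l\<in>{i..j}. (\<Oplus>k\<in>{i..l}. ?a k \<otimes> (\<sigma> ^^ (k - i)) (?b k l)) \<otimes> (\<sigma> ^^ (l - i)) (?c l))"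
    using ij unfolding T_mult by (auto intro!: finsum_cong' finsum_closed)
  \<comment> \<open>The new terms have \<open>k > l\<close>, and there the entry of \<open>B\<close>
    lies below the diagonal.\<close>
  also have "\<dots> = (\<Oplus>l\<in>{i..j}. (\<Oplus>k\<in>{i..j}. ?a k \<otimes> (\<sigma> ^^ (k - i)) (?b k l)) \<otimes> (\<sigma> ^^ (l - i)) (?c l))"
  proof (rule finsum_cong', rule refl)
    fix l
    assume "l \<in> {i..j}"
    then show "(\<Oplus>k\<in>{i..l}. ?a k \<otimes> (\<sigma> ^^ (k - i)) (?b k l)) \<otimes> (\<sigma> ^^ (l - i)) (?c l) =
        (\<Oplus>k\<in>{i..j}. ?a k \<otimes> (\<sigma> ^^ (k - i)) (?b k l)) \<otimes> (\<sigma> ^^ (l - i)) (?c l)"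
      using ij T_entry_zero[OF B]
      by (intro arg_cong2[where f = "(\<otimes>)"] add.finprod_mono_neutral_cong_left) auto
  qed (use ij in \<open>auto intro!: finsum_closed\<close>)
  also have "\<dots> = (\<Oplus>l\<in>{i..j}. \<Oplus>k\<in>{i..j}. ?a k \<otimes> (\<sigma> ^^ (k - i)) (?b k l) \<otimes> (\<sigma> ^^ (l - i)) (?c l))"
    using ij by (intro finsum_cong' refl finsum_ldistr) (auto intro!: finsum_closed)
  also have "\<dots> = (\<Oplus>k\<in>{i..j}. \<Oplus>l\<in>{i..j}. ?a k \<otimes> (\<sigma> ^^ (k - i)) (?b k l) \<otimes> (\<sigma> ^^ (l - i)) (?c l))"
    using ij by (intro finsum_finsum_swap) auto
  also have "\<dots> = (\<Oplus>k\<in>{i..j}. \<Oplus>l\<in>{k..j}. ?a k \<otimes> (\<sigma> ^^ (k - i)) (?b k l \<otimes> (\<sigma> ^^ (l - k)) (?c l)))"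
  proof (rule finsum_cong', rule refl)
    fix k
    assume k: "k \<in> {i..j}"
    \<comment> \<open>The exponents satisfy \<open>l - i = (k - i) + (l - k)\<close>, so
      \<open>\<sigma>^(k-i)\<close> can be taken out of the product of the entries of
      \<open>B\<close> and \<open>C\<close>.\<close>
    have pow: "(\<sigma> ^^ (l - i)) x = (\<sigma> ^^ (k - i)) ((\<sigma> ^^ (l - k)) x)" if "l \<in> {k..j}" for l x
      using k that by (simp add: funpow_add[symmetric, THEN fun_cong, simplified])
    show "(\<Oplus>l\<in>{i..j}. ?a k \<otimes> (\<sigma> ^^ (k - i)) (?b k l) \<otimes> (\<sigma> ^^ (l - i)) (?c l)) =
        (\<Oplus>l\<in>{k..j}. ?a k \<otimes> (\<sigma> ^^ (k - i)) (?b k l \<otimes> (\<sigma> ^^ (l - k)) (?c l)))"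
    proof (rule add.finprod_mono_neutral_cong_right)
      fix l
      assume l: "l \<in> {k..j}"
      show "?a k \<otimes> (\<sigma> ^^ (k - i)) (?b k l) \<otimes> (\<sigma> ^^ (l - i)) (?c l) =
          ?a k \<otimes> (\<sigma> ^^ (k - i)) (?b k l \<otimes> (\<sigma> ^^ (l - k)) (?c l))"
        unfolding pow[OF l] using ij k l by (simp add: m_assoc)
    qed (use ij k T_entry_zero[OF B] in auto)
  qed (use ij in \<open>auto intro!: finsum_closed\<close>)
  also have "\<dots> = (\<Oplus>k\<in>{i..j}. ?a k \<otimes> (\<sigma> ^^ (k - i)) (\<Oplus>l\<in>{k..j}. ?b k l \<otimes> (\<sigma> ^^ (l - k)) (?c l)))"
  proof (rule finsum_cong', rule refl)
    fix k
    assume k: "k \<in> {i..j}"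
    have "(\<lambda>l. ?b k l \<otimes> (\<sigma> ^^ (l - k)) (?c l)) \<in> {k..j} \<rightarrow> carrier R"
      using ij k by auto
    then show "(\<Oplus>l\<in>{k..j}. ?a k \<otimes> (\<sigma> ^^ (k - i)) (?b k l \<otimes> (\<sigma> ^^ (l - k)) (?c l))) =
        ?a k \<otimes> (\<sigma> ^^ (k - i)) (\<Oplus>l\<in>{k..j}. ?b k l \<otimes> (\<sigma> ^^ (l - k)) (?c l))"
      using ij k by (subst funpow_finsum) (auto simp: Pi_def intro!: finsum_rdistr[symmetric])
  qed (use ij in \<open>auto intro!: finsum_closed\<close>)
  also have "\<dots> = (A \<otimes>\<^bsub>T n\<^esub> (B \<otimes>\<^bsub>T n\<^esub> C)) $$ (i, j)"
    using ij unfolding T_mult by (auto intro!: finsum_cong' finsum_closed)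
  finally show "(A \<otimes>\<^bsub>T n\<^esub> B \<otimes>\<^bsub>T n\<^esub> C) $$ (i, j) = (A \<otimes>\<^bsub>T n\<^esub> (B \<otimes>\<^bsub>T n\<^esub> C)) $$ (i, j)" .
qed (use assms in \<open>auto intro!: T_mult_closed\<close>)

lemma T_one_closed: "\<one>\<^bsub>T n\<^esub> \<in> carrier (T n)"
  by (simp add: T_carrier_iff T_one)

lemma T_l_one:
  assumes "A \<in> carrier (T n)"
  shows "\<one>\<^bsub>T n\<^esub> \<otimes>\<^bsub>T n\<^esub> A = A"
proof (rule T_eqI)
  fix i j
  assume ij: "i \<le> j" "j < n"
  then have "(\<one>\<^bsub>T n\<^esub> \<otimes>\<^bsub>T n\<^esub> A) $$ (i, j) = (\<Oplus>k\<in>{i..j}. if i = k then A $$ (k, j) else \<zero>)"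
    using T_entry_closed[OF assms]
    by (auto simp: T_mult T_one intro!: finsum_cong')
  also have "\<dots> = A $$ (i, j)"
    using ij T_entry_closed[OF assms] by (subst finsum_singleton) auto
  finally show "(\<one>\<^bsub>T n\<^esub> \<otimes>\<^bsub>T n\<^esub> A) $$ (i, j) = A $$ (i, j)" .
qed (use assms in \<open>auto intro!: T_mult_closed T_one_closed\<close>)

lemma T_r_one:
  assumes "A \<in> carrier (T n)"
  shows "A \<otimes>\<^bsub>T n\<^esub> \<one>\<^bsub>T n\<^esub> = A"
proof (rule T_eqI)
  fix i j
  assume ij: "i \<le> j" "j < n"
  then have "(A \<otimes>\<^bsub>T n\<^esub> \<one>\<^bsub>T n\<^esub>) $$ (i, j) = (\<Oplus>k\<in>{i..j}. if j = k then A $$ (i, k) else \<zero>)"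
    using T_entry_closed[OF assms]
    by (auto simp: T_mult T_one intro!: finsum_cong')
  also have "\<dots> = A $$ (i, j)"
    using ij T_entry_closed[OF assms] by (subst finsum_singleton) auto
  finally show "(A \<otimes>\<^bsub>T n\<^esub> \<one>\<^bsub>T n\<^esub>) $$ (i, j) = A $$ (i, j)" .
qed (use assms in \<open>auto intro!: T_mult_closed T_one_closed\<close>)

text \<open>Both identities hold term by term in the sums for the entries. The second one also uses
  that the iterates of \<open>\<sigma>\<close> are additive.\<close>

lemma T_distr:
  assumes A: "A \<in> carrier (T n)" and B: "B \<in> carrier (T n)" and C: "C \<in> carrier (T n)"
  shows "(A \<oplus>\<^bsub>T n\<^esub> B) \<otimes>\<^bsub>T n\<^esub> C = A \<otimes>\<^bsub>T n\<^esub> C \<oplus>\<^bsub>T n\<^esub> B \<otimes>\<^bsub>T n\<^esub> C"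
    and "C \<otimes>\<^bsub>T n\<^esub> (A \<oplus>\<^bsub>T n\<^esub> B) = C \<otimes>\<^bsub>T n\<^esub> A \<oplus>\<^bsub>T n\<^esub> C \<otimes>\<^bsub>T n\<^esub> B"
proof -
  note [simp] = T_entry_closed[OF A] T_entry_closed[OF B] T_entry_closed[OF C]
  show "(A \<oplus>\<^bsub>T n\<^esub> B) \<otimes>\<^bsub>T n\<^esub> C = A \<otimes>\<^bsub>T n\<^esub> C \<oplus>\<^bsub>T n\<^esub> B \<otimes>\<^bsub>T n\<^esub> C"
  proof (rule T_eqI)
    fix i j
    assume ij: "i \<le> j" "j < n"
    have "((A \<oplus>\<^bsub>T n\<^esub> B) \<otimes>\<^bsub>T n\<^esub> C) $$ (i, j) =
        (\<Oplus>k\<in>{i..j}. A $$ (i, k) \<otimes> (\<sigma> ^^ (k - i)) (C $$ (k, j)) \<oplus> B $$ (i, k) \<otimes> (\<sigma> ^^ (k - i)) (C $$ (k, j)))"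
      using ij by (auto simp: T_mult T_add l_distr simp del: finsum_addf intro!: finsum_cong')
    also have "\<dots> = (A \<otimes>\<^bsub>T n\<^esub> C \<oplus>\<^bsub>T n\<^esub> B \<otimes>\<^bsub>T n\<^esub> C) $$ (i, j)"
      using ij by (auto simp: T_mult T_add)
    finally show "((A \<oplus>\<^bsub>T n\<^esub> B) \<otimes>\<^bsub>T n\<^esub> C) $$ (i, j) =
        (A \<otimes>\<^bsub>T n\<^esub> C \<oplus>\<^bsub>T n\<^esub> B \<otimes>\<^bsub>T n\<^esub> C) $$ (i, j)" .
  qed (use assms in \<open>auto intro!: T_mult_closed T_add_closed\<close>)
  show "C \<otimes>\<^bsub>T n\<^esub> (A \<oplus>\<^bsub>T n\<^esub> B) = C \<otimes>\<^bsub>T n\<^esub> A \<oplus>\<^bsub>T n\<^esub> C \<otimes>\<^bsub>T n\<^esub> B"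
  proof (rule T_eqI)
    fix i j
    assume ij: "i \<le> j" "j < n"
    have "(C \<otimes>\<^bsub>T n\<^esub> (A \<oplus>\<^bsub>T n\<^esub> B)) $$ (i, j) =
        (\<Oplus>k\<in>{i..j}. C $$ (i, k) \<otimes> (\<sigma> ^^ (k - i)) (A $$ (k, j)) \<oplus> C $$ (i, k) \<otimes> (\<sigma> ^^ (k - i)) (B $$ (k, j)))"
      using ij by (auto simp: T_mult T_add r_distr simp del: finsum_addf intro!: finsum_cong')
    also have "\<dots> = (C \<otimes>\<^bsub>T n\<^esub> A \<oplus>\<^bsub>T n\<^esub> C \<otimes>\<^bsub>T n\<^esub> B) $$ (i, j)"
      using ij by (auto simp: T_mult T_add)
    finally show "(C \<otimes>\<^bsub>T n\<^esub> (A \<oplus>\<^bsub>T n\<^esub> B)) $$ (i, j) =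
        (C \<otimes>\<^bsub>T n\<^esub> A \<oplus>\<^bsub>T n\<^esub> C \<otimes>\<^bsub>T n\<^esub> B) $$ (i, j)" .
  qed (use assms in \<open>auto intro!: T_mult_closed T_add_closed\<close>)
qed

lemma T_ring: "ring (T n)"
proof (rule ringI)
  show "abelian_group (T n)"
  proof (rule abelian_groupI)
    fix A
    assume A: "A \<in> carrier (T n)"
    then show "\<exists>B\<in>carrier (T n). B \<oplus>\<^bsub>T n\<^esub> A = \<zero>\<^bsub>T n\<^esub>"
      by (intro bexI[of _ "mat n n (\<lambda>(i, j). \<ominus> A $$ (i, j))"])
        (auto simp: T_carrier_iff T_add T_zero l_neg intro!: eq_matI)
  qed (auto simp: T_carrier_iff T_add T_zero a_ac intro!: eq_matI)
  show "monoid (T n)"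
    by (rule monoidI) (auto simp: T_mult_closed T_one_closed T_assoc T_l_one T_r_one)
qed (auto simp: T_distr)

section \<open>Upper triangular three by three matrices through their six entries\<close>

definition tri3 :: "'a \<Rightarrow> 'a \<Rightarrow> 'a \<Rightarrow> 'a \<Rightarrow> 'a \<Rightarrow> 'a \<Rightarrow> 'a mat" where
  "tri3 a b c d e f = mat 3 3 (\<lambda>(i, j). [[a, b, c], [\<zero>, d, e], [\<zero>, \<zero>, f]] ! i ! j)"

lemma tri3_index [simp]:
  "tri3 a b c d e f $$ (0, 0) = a" "tri3 a b c d e f $$ (0, Suc 0) = b" "tri3 a b c d e f $$ (0, 2) = c"
  "tri3 a b c d e f $$ (Suc 0, Suc 0) = d" "tri3 a b c d e f $$ (Suc 0, 2) = e"
  "tri3 a b c d e f $$ (2, 2) = f"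
  by (simp_all add: tri3_def)

lemma tri3_closed:
  assumes "a \<in> carrier R" "b \<in> carrier R" "c \<in> carrier R" "d \<in> carrier R" "e \<in> carrier R" "f \<in> carrier R"
  shows "tri3 a b c d e f \<in> carrier (T 3)"
  using assms by (simp add: T_carrier_iff tri3_def numeral_3_eq_3 All_less_Suc)

lemma T3_eqI:
  assumes "A \<in> carrier (T 3)" "B \<in> carrier (T 3)"
    and "A $$ (0, 0) = B $$ (0, 0)" "A $$ (0, Suc 0) = B $$ (0, Suc 0)" "A $$ (0, 2) = B $$ (0, 2)"
    and "A $$ (Suc 0, Suc 0) = B $$ (Suc 0, Suc 0)" "A $$ (Suc 0, 2) = B $$ (Suc 0, 2)"
    and "A $$ (2, 2) = B $$ (2, 2)"
  shows "A = B"
proof (rule T_eqI[OF assms(1,2)])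
  fix i j :: nat
  assume "i \<le> j" "j < 3"
  then consider "i = 0" "j = 0" | "i = 0" "j = Suc 0" | "i = 0" "j = 2"
    | "i = Suc 0" "j = Suc 0" | "i = Suc 0" "j = 2" | "i = 2" "j = 2"
    by linarith
  then show "A $$ (i, j) = B $$ (i, j)"
    using assms by cases auto
qed

lemma T3_cases:
  assumes "A \<in> carrier (T 3)"
  obtains a b c d e f where "A = tri3 a b c d e f" "a \<in> carrier R" "b \<in> carrier R" "c \<in> carrier R"
    "d \<in> carrier R" "e \<in> carrier R" "f \<in> carrier R"
proof (rule that)
  show "A = tri3 (A $$ (0, 0)) (A $$ (0, 1)) (A $$ (0, 2)) (A $$ (1, 1)) (A $$ (1, 2)) (A $$ (2, 2))"
    by (rule T3_eqI) (simp_all add: assms tri3_closed T_entry_closed[OF assms])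
qed (simp_all add: T_entry_closed[OF assms])

lemma tri3_one: "\<one>\<^bsub>T 3\<^esub> = tri3 \<one> \<zero> \<zero> \<one> \<zero> \<one>"
  by (rule T3_eqI) (simp_all add: tri3_closed T_one_closed, simp_all add: T_one)

lemma tri3_add:
  assumes "a \<in> carrier R" "b \<in> carrier R" "c \<in> carrier R" "d \<in> carrier R" "e \<in> carrier R" "f \<in> carrier R"
    and "a' \<in> carrier R" "b' \<in> carrier R" "c' \<in> carrier R" "d' \<in> carrier R" "e' \<in> carrier R" "f' \<in> carrier R"
  shows "tri3 a b c d e f \<oplus>\<^bsub>T 3\<^esub> tri3 a' b' c' d' e' f' =
    tri3 (a \<oplus> a') (b \<oplus> b') (c \<oplus> c') (d \<oplus> d') (e \<oplus> e') (f \<oplus> f')"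
  by (rule T3_eqI) (simp_all add: assms tri3_closed T_add_closed, simp_all add: T_add)

text \<open>The twist depends on how far the left factor's entry lies from the diagonal: diagonal
  entries leave their partner unchanged, those next to the diagonal apply \<open>\<sigma>\<close>
  once, and the corner applies it twice.\<close>

lemma tri3_mult:
  assumes "a \<in> carrier R" "b \<in> carrier R" "c \<in> carrier R" "d \<in> carrier R" "e \<in> carrier R" "f \<in> carrier R"
    and "a' \<in> carrier R" "b' \<in> carrier R" "c' \<in> carrier R" "d' \<in> carrier R" "e' \<in> carrier R" "f' \<in> carrier R"
  shows "tri3 a b c d e f \<otimes>\<^bsub>T 3\<^esub> tri3 a' b' c' d' e' f' =
    tri3 (a \<otimes> a') (a \<otimes> b' \<oplus> b \<otimes> \<sigma> d') (a \<otimes> c' \<oplus> b \<otimes> \<sigma> e' \<oplus> c \<otimes> \<sigma> (\<sigma> f'))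
      (d \<otimes> d') (d \<otimes> e' \<oplus> e \<otimes> \<sigma> f') (f \<otimes> f')"
proof (rule T3_eqI)
  have sets: "{0..2} = {0, Suc 0, 2}" "{0..Suc 0} = {0, Suc 0}" "{Suc 0..2} = {Suc 0, 2}"
    by auto
  have "\<sigma> ^^ 2 = \<sigma> \<circ> \<sigma>"
    by (simp add: numeral_2_eq_2)
  note simps = T_mult sets this a_assoc
  let ?AB = "tri3 a b c d e f \<otimes>\<^bsub>T 3\<^esub> tri3 a' b' c' d' e' f'"
  show "?AB \<in> carrier (T 3)"
    using assms by (intro T_mult_closed tri3_closed)
  let ?C = "tri3 (a \<otimes> a') (a \<otimes> b' \<oplus> b \<otimes> \<sigma> d') (a \<otimes> c' \<oplus> b \<otimes> \<sigma> e' \<oplus> c \<otimes> \<sigma> (\<sigma> f'))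
      (d \<otimes> d') (d \<otimes> e' \<oplus> e \<otimes> \<sigma> f') (f \<otimes> f')"
  show "?C \<in> carrier (T 3)"
    using assms by (intro tri3_closed) auto
  show "?AB $$ (0, 0) = ?C $$ (0, 0)" "?AB $$ (0, Suc 0) = ?C $$ (0, Suc 0)"
    "?AB $$ (0, 2) = ?C $$ (0, 2)" "?AB $$ (Suc 0, Suc 0) = ?C $$ (Suc 0, Suc 0)"
    "?AB $$ (Suc 0, 2) = ?C $$ (Suc 0, 2)" "?AB $$ (2, 2) = ?C $$ (2, 2)"
    using assms by (simp_all add: simps)
qed

text \<open>Back substitution produces a right inverse whose diagonal again consists of units. The
  set of all such matrices is therefore closed under taking right inverses, and the general
  criterion applies.\<close>

lemma tri3_Unit:
  assumes "a \<in> Units R" "d \<in> Units R" "f \<in> Units R"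
    and "b \<in> carrier R" "c \<in> carrier R" "e \<in> carrier R"
  shows "tri3 a b c d e f \<in> Units (T 3)"
proof -
  interpret T: ring "T 3"
    by (rule T_ring)
  let ?S = "{tri3 a b c d e f | a b c d e f. a \<in> Units R \<and> d \<in> Units R \<and> f \<in> Units R \<and>
    b \<in> carrier R \<and> c \<in> carrier R \<and> e \<in> carrier R}"
  have cancel: "u \<otimes> (\<ominus> (inv u \<otimes> x)) \<oplus> x = \<zero>" if "u \<in> Units R" "x \<in> carrier R" for u x
    using that Units_closed[OF that(1)] by (simp add: r_minus m_assoc[symmetric] l_neg)
  show ?thesis
  proof (rule T.Unit_if_right_invertible_closed[of ?S])
    show "?S \<subseteq> carrier (T 3)"
      by (auto intro!: tri3_closed)
    show "tri3 a b c d e f \<in> ?S"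
      using assms by blast
    fix A
    assume "A \<in> ?S"
    then obtain a b c d e f where A: "A = tri3 a b c d e f"
      and U: "a \<in> Units R" "d \<in> Units R" "f \<in> Units R"
      and C: "b \<in> carrier R" "c \<in> carrier R" "e \<in> carrier R"
      by blast
    \<comment> \<open>The three entries make the positions \<open>(1, 2)\<close>,
      \<open>(0, 1)\<close> and \<open>(0, 2)\<close> of the product vanish. The corner comes last,
      since its equation involves \<open>e'\<close>.\<close>
    define e' where "e' = \<ominus> (inv d \<otimes> (e \<otimes> \<sigma> (inv f)))"
    define b' where "b' = \<ominus> (inv a \<otimes> (b \<otimes> \<sigma> (inv d)))"
    define c' where "c' = \<ominus> (inv a \<otimes> (b \<otimes> \<sigma> e' \<oplus> c \<otimes> \<sigma> (\<sigma> (inv f))))"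
    have C': "b' \<in> carrier R" "c' \<in> carrier R" "e' \<in> carrier R"
      using U C by (simp_all add: b'_def c'_def e'_def)
    have "a \<otimes> b' \<oplus> b \<otimes> \<sigma> (inv d) = \<zero>"
      unfolding b'_def using U C by (intro cancel) auto
    moreover have "d \<otimes> e' \<oplus> e \<otimes> \<sigma> (inv f) = \<zero>"
      unfolding e'_def using U C by (intro cancel) auto
    moreover have "a \<otimes> c' \<oplus> (b \<otimes> \<sigma> e' \<oplus> c \<otimes> \<sigma> (\<sigma> (inv f))) = \<zero>"
      unfolding c'_def using U C C' by (intro cancel) auto
    ultimately have "A \<otimes>\<^bsub>T 3\<^esub> tri3 (inv a) b' c' (inv d) e' (inv f) = \<one>\<^bsub>T 3\<^esub>"
      unfolding A tri3_one using U U[THEN Units_closed] C C' by (simp add: tri3_mult a_assoc)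
    moreover have "tri3 (inv a) b' c' (inv d) e' (inv f) \<in> ?S"
      using U C' by blast
    ultimately show "\<exists>B\<in>?S. A \<otimes>\<^bsub>T 3\<^esub> B = \<one>\<^bsub>T 3\<^esub>"
      by blast
  qed
qed

text \<open>The matrix \<open>A - E\<close> is triangular, so it is a unit as soon as its diagonal
  entries are. The off-diagonal entries of \<open>E\<close> only have to serve idempotency and
  commutation.\<close>

lemma strongly_clean_tri3I:
  assumes A: "a1 \<in> carrier R" "a12 \<in> carrier R" "a13 \<in> carrier R"
      "a2 \<in> carrier R" "a23 \<in> carrier R" "a3 \<in> carrier R"
    and E: "e1 \<in> carrier R" "e12 \<in> carrier R" "e13 \<in> carrier R"
      "e2 \<in> carrier R" "e23 \<in> carrier R" "e3 \<in> carrier R"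
    and idem: "tri3 e1 e12 e13 e2 e23 e3 \<otimes>\<^bsub>T 3\<^esub> tri3 e1 e12 e13 e2 e23 e3 = tri3 e1 e12 e13 e2 e23 e3"
    and comm: "tri3 a1 a12 a13 a2 a23 a3 \<otimes>\<^bsub>T 3\<^esub> tri3 e1 e12 e13 e2 e23 e3 =
      tri3 e1 e12 e13 e2 e23 e3 \<otimes>\<^bsub>T 3\<^esub> tri3 a1 a12 a13 a2 a23 a3"
    and Units: "a1 \<ominus> e1 \<in> Units R" "a2 \<ominus> e2 \<in> Units R" "a3 \<ominus> e3 \<in> Units R"
  shows "strongly_clean (T 3) (tri3 a1 a12 a13 a2 a23 a3)"
proof -
  interpret T: ring "T 3"
    by (rule T_ring)
  have cancel: "e \<oplus> (a \<ominus> e) = a" if "a \<in> carrier R" "e \<in> carrier R" for a e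
    using that by algebra
  show ?thesis
  proof (rule T.strongly_cleanI[OF tri3_closed[OF E] idem _ _ comm])
    show "tri3 (a1 \<ominus> e1) (a12 \<ominus> e12) (a13 \<ominus> e13) (a2 \<ominus> e2) (a23 \<ominus> e23) (a3 \<ominus> e3) \<in> Units (T 3)"
      using Units A E by (intro tri3_Unit) auto
    show "tri3 a1 a12 a13 a2 a23 a3 = tri3 e1 e12 e13 e2 e23 e3 \<oplus>\<^bsub>T 3\<^esub>
        tri3 (a1 \<ominus> e1) (a12 \<ominus> e12) (a13 \<ominus> e13) (a2 \<ominus> e2) (a23 \<ominus> e23) (a3 \<ominus> e3)"
      using A E by (simp add: tri3_add cancel)
  qed
qed

end

section \<open>Strongly clean matrices over a local ring\<close>

text \<open>Position \<open>(i, j)\<close> carries the twist \<open>\<sigma>^(j-i)\<close>: one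
  application next to the diagonal, two in the corner. Once the first diagonal entry is a unit, a
  radical row entry can meet a unit column entry only at position \<open>(1, 2)\<close>, which is
  governed by \<open>surj_rad_unit\<close>.\<close>

locale local_ring_endomorphism = local_ring R + ring_endomorphism R \<sigma>
  for R (structure) and \<sigma> +
  assumes surj_unit_rad: "\<lbrakk>a \<in> Units R; b \<in> jacobson_radical R\<rbrakk> \<Longrightarrow>
      left_minus_right R a (\<sigma> b) ` carrier R = carrier R"
    and surj_unit_rad2: "\<lbrakk>a \<in> Units R; b \<in> jacobson_radical R\<rbrakk> \<Longrightarrow>
      left_minus_right R a (\<sigma> (\<sigma> b)) ` carrier R = carrier R"
    and surj_rad_unit: "\<lbrakk>a \<in> Units R; b \<in> jacobson_radical R\<rbrakk> \<Longrightarrow>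
      left_minus_right R b (\<sigma> a) ` carrier R = carrier R"
begin

text \<open>As \<open>a1\<close> is a unit, the idempotent starts with \<open>0\<close>. The four
  cases are the possible values of its two other diagonal entries. In each case \<open>x\<close>,
  \<open>y\<close> and \<open>z\<close> denote its entries at \<open>(0, 1)\<close>,
  \<open>(1, 2)\<close> and \<open>(0, 2)\<close> where these have to be solved for.\<close>

lemma strongly_clean_tri3_Unit:
  assumes a1: "a1 \<in> Units R" and A: "a12 \<in> carrier R" "a13 \<in> carrier R"
    "a2 \<in> carrier R" "a23 \<in> carrier R" "a3 \<in> carrier R"
  shows "strongly_clean (T 3) (tri3 a1 a12 a13 a2 a23 a3)"
proof -
  have a1': "a1 \<in> carrier R" "a1 \<ominus> \<zero> \<in> Units R"
    using a1 Units_closed[OF a1] by (simp_all add: minus_eq)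
  have rad: "x \<ominus> \<one> \<in> Units R" if "x \<in> carrier R" "x \<in> jacobson_radical R" for x
  proof -
    have "x \<ominus> \<one> = \<ominus> (\<one> \<ominus> x)"
      using that(1) by algebra
    then show ?thesis
      using Units_minus_closed[OF Unit_one_minus_if_in_jacobson_radical[OF that(2)]] by simp
  qed
  have nrad: "x \<in> Units R" "x \<ominus> \<zero> \<in> Units R" if "x \<in> carrier R" "x \<notin> jacobson_radical R" for x
    using Unit_if_notin_jacobson_radical[OF that] that(1) by (simp_all add: minus_eq)
  consider (units) "a2 \<notin> jacobson_radical R" "a3 \<notin> jacobson_radical R"
    | (last_rad) "a2 \<notin> jacobson_radical R" "a3 \<in> jacobson_radical R"
    | (mid_rad) "a2 \<in> jacobson_radical R" "a3 \<notin> jacobson_radical R"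
    | (both_rad) "a2 \<in> jacobson_radical R" "a3 \<in> jacobson_radical R"
    by blast
  then show ?thesis
  proof cases
    \<comment> \<open>All diagonal entries are units, so the matrix is itself a unit and the zero
      idempotent suffices.\<close>
    case units
    then show ?thesis
      by (intro strongly_clean_tri3I[where ?e1.0 = \<zero> and ?e12.0 = \<zero> and ?e13.0 = \<zero>
            and ?e2.0 = \<zero> and ?e23.0 = \<zero> and ?e3.0 = \<zero>])
        (use A a1' nrad in \<open>auto simp: tri3_mult\<close>)
  next
    case last_rad
    \<comment> \<open>The diagonal of \<open>E\<close> is \<open>(0, 0, 1)\<close>, and
      \<open>E\<close> is idempotent for every choice of \<open>y\<close> and \<open>z\<close> in
      its last column. Commutation gives one equation for each; \<open>y\<close> is found first
      because it enters the equation for \<open>z\<close>.\<close>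
    obtain y where y: "y \<in> carrier R" "a2 \<otimes> y \<oplus> a23 = \<zero> \<oplus> y \<otimes> \<sigma> a3"
      by (rule left_minus_right_surjD[OF surj_unit_rad[OF nrad(1) last_rad(2)], of a2 a23 \<zero>])
        (use A last_rad in auto)
    obtain z where z: "z \<in> carrier R"
        "a1 \<otimes> z \<oplus> (a12 \<otimes> \<sigma> y \<oplus> a13) = \<zero> \<oplus> z \<otimes> \<sigma> (\<sigma> a3)"
      by (rule left_minus_right_surjD[OF surj_unit_rad2[OF a1 last_rad(2)],
            of "a12 \<otimes> \<sigma> y \<oplus> a13" \<zero>]) (use A y a1' in auto)
    show ?thesis
      by (rule strongly_clean_tri3I[where ?e1.0 = \<zero> and ?e12.0 = \<zero> and ?e13.0 = z
            and ?e2.0 = \<zero> and ?e23.0 = y and ?e3.0 = \<one>])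
        (use A a1' nrad rad y z last_rad in \<open>auto simp: tri3_mult a_assoc\<close>)
  next
    case mid_rad
    obtain x where x: "x \<in> carrier R" "a1 \<otimes> x \<oplus> a12 = \<zero> \<oplus> x \<otimes> \<sigma> a2"
      by (rule left_minus_right_surjD[OF surj_unit_rad[OF a1 mid_rad(1)], of a12 \<zero>])
        (use A a1' in auto)
    \<comment> \<open>Here the row entry \<open>a2\<close> is radical and the column entry
      \<open>a3\<close> a unit, so the roles in the Sylvester equation are reversed.\<close>
    obtain y where y: "y \<in> carrier R" "a2 \<otimes> y \<oplus> \<zero> = a23 \<oplus> y \<otimes> \<sigma> a3"
      by (rule left_minus_right_surjD[OF surj_rad_unit[OF nrad(1) mid_rad(1)], of a3 \<zero> a23])
        (use A mid_rad in auto)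
    \<comment> \<open>With \<open>e\<^sub>1 = e\<^sub>3 = 0\<close>, idempotency forces the corner entry \<open>x \<sigma>(y)\<close>.\<close>
    have "a1 \<otimes> (x \<otimes> \<sigma> y) \<oplus> a12 \<otimes> \<sigma> y = (a1 \<otimes> x \<oplus> a12) \<otimes> \<sigma> y"
      using A a1' x(1) y(1) by (simp add: l_distr m_assoc)
    \<comment> \<open>Substituting the equation for \<open>x\<close>, and then the image under
      \<open>\<sigma>\<close> of the one for \<open>y\<close>, turns the corner of
      \<open>A E\<close> into that of \<open>E A\<close>, up to terms with a factor zero.\<close>
    also have "\<dots> = x \<otimes> \<sigma> (a2 \<otimes> y \<oplus> \<zero>)"
      unfolding x(2) using A x(1) y(1) by (simp add: m_assoc)
    also have "\<dots> = x \<otimes> \<sigma> a23 \<oplus> x \<otimes> \<sigma> y \<otimes> \<sigma> (\<sigma> a3)"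
      unfolding y(2) using A x y(1) by (simp add: r_distr m_assoc)
    finally have "a1 \<otimes> (x \<otimes> \<sigma> y) \<oplus> a12 \<otimes> \<sigma> y = x \<otimes> \<sigma> a23 \<oplus> x \<otimes> \<sigma> y \<otimes> \<sigma> (\<sigma> a3)" .
    then show ?thesis
      by (intro strongly_clean_tri3I[where ?e1.0 = \<zero> and ?e12.0 = x and ?e13.0 = "x \<otimes> \<sigma> y"
            and ?e2.0 = \<one> and ?e23.0 = y and ?e3.0 = \<zero>])
        (use A a1' nrad rad x y mid_rad in \<open>auto simp: tri3_mult\<close>)
  next
    case both_rad
    \<comment> \<open>The diagonal of \<open>E\<close> is \<open>(0, 1, 1)\<close>. Idempotency at
      \<open>(1, 2)\<close> reads \<open>y + y = y\<close> and forces the entry \<open>0\<close>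
      there; commutation at that position then holds, and \<open>x\<close> and \<open>z\<close>
      remain to be found.\<close>
    obtain x where x: "x \<in> carrier R" "a1 \<otimes> x \<oplus> a12 = \<zero> \<oplus> x \<otimes> \<sigma> a2"
      by (rule left_minus_right_surjD[OF surj_unit_rad[OF a1 both_rad(1)], of a12 \<zero>])
        (use A a1' in auto)
    obtain z where z: "z \<in> carrier R"
        "a1 \<otimes> z \<oplus> a13 = x \<otimes> \<sigma> a23 \<oplus> z \<otimes> \<sigma> (\<sigma> a3)"
      by (rule left_minus_right_surjD[OF surj_unit_rad2[OF a1 both_rad(2)],
            of a13 "x \<otimes> \<sigma> a23"]) (use A x a1' in auto)
    show ?thesis
      by (rule strongly_clean_tri3I[where ?e1.0 = \<zero> and ?e12.0 = x and ?e13.0 = z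
            and ?e2.0 = \<one> and ?e23.0 = \<zero> and ?e3.0 = \<one>])
        (use A a1' rad x z both_rad in \<open>auto simp: tri3_mult\<close>)
  qed
qed

text \<open>If the first diagonal entry is radical, \<open>1 - A\<close> has a unit in that place,
  and strong cleanness passes from \<open>1 - A\<close> back to \<open>A\<close>.\<close>

lemma strongly_clean_T3:
  assumes "A \<in> carrier (T 3)"
  shows "strongly_clean (T 3) A"
proof -
  interpret T: ring "T 3"
    by (rule T_ring)
  obtain a b c d e f where A: "A = tri3 a b c d e f"
    and C: "a \<in> carrier R" "b \<in> carrier R" "c \<in> carrier R"
      "d \<in> carrier R" "e \<in> carrier R" "f \<in> carrier R"
    by (rule T3_cases[OF assms])
  show ?thesis
  proof (cases "a \<in> jacobson_radical R")
    case False
    then show ?thesis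
      unfolding A using C Unit_if_notin_jacobson_radical by (intro strongly_clean_tri3_Unit) auto
  next
    case True
    \<comment> \<open>This is \<open>1 - A\<close> written out by entries.\<close>
    let ?B = "tri3 (\<one> \<ominus> a) (\<ominus> b) (\<ominus> c) (\<one> \<ominus> d) (\<ominus> e) (\<one> \<ominus> f)"
    show ?thesis
    proof (rule T.strongly_clean_complement[OF assms])
      show "?B \<in> carrier (T 3)"
        using C by (intro tri3_closed) auto
      have "x \<oplus> (\<one> \<ominus> x) = \<one>" if "x \<in> carrier R" for x
        using that by algebra
      then show "A \<oplus>\<^bsub>T 3\<^esub> ?B = \<one>\<^bsub>T 3\<^esub>"
        unfolding A using C by (simp add: tri3_add tri3_one r_neg)
      show "strongly_clean (T 3) ?B"
        using C Unit_one_minus_if_in_jacobson_radical[OF True]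
        by (intro strongly_clean_tri3_Unit) auto
    qed
  qed
qed

end

theorem theorem3p1:
  fixes R :: "('a, 'm) ring_scheme" and \<sigma> :: "'a \<Rightarrow> 'a"
  assumes "local_ring R"
    and "\<sigma> \<in> Ring.ring_hom R R"
    and "\<And>a b. \<lbrakk>a \<in> Units R; b \<in> jacobson_radical R\<rbrakk> \<Longrightarrow>
           left_minus_right R a (\<sigma> b) ` carrier R = carrier R \<and>
           left_minus_right R a ((\<sigma> \<circ> \<sigma>) b) ` carrier R = carrier R \<and>
           left_minus_right R b (\<sigma> a) ` carrier R = carrier R"
  shows "strongly_clean_ring (skew_upper_triangular_ring R \<sigma> 3)"
proof -
  interpret local_ring R
    by fact
  interpret local_ring_endomorphism R \<sigma>
    using assms(2,3) by unfold_locales auto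
  show ?thesis
    by (intro strongly_clean_ring.intro strongly_clean_ring_axioms.intro T_ring strongly_clean_T3)
qed

end
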